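(* Let $k\ge 1$ be an integer and let $\mathbb{F}$ be a topological field. Then there is a continuous, free, and transitive action of $G(\mathbb{F})=(GL_k(\mathbb{F})\times GL_{k+1}(\mathbb{F}))/N$ on the set $M_k(\mathbb{F})$ of nondegenerate $2\times k\times(k+1)$ hypermatrices over $\mathbb{F}$, namely the action induced by the natural action of $GL_k(\mathbb{F})\times GL_{k+1}(\mathbb{F})$ on $\mathbb{F}^2\otimes\mathbb{F}^k\otimes\mathbb{F}^{k+1}$.
   Context: A $2\times k\times(k+1)$ hypermatrix over $\mathbb{F}$ is an element of $\mathbb{F}^2\otimes\mathbb{F}^k\otimes\mathbb{F}^{k+1}$; it is written as a pair $(M_0,M_1)$ of $(k+1)\times k$ matrices over $\mathbb{F}$ (its two slices), with rows indexed by $0,\dots,k$ and columns by $0,\dots,k-1$. It is degenerate (i.e. has zero hyperdeterminant) if there are nonzero vectors $x\in\overline{\mathbb{F}}^2$, $y\in\overline{\mathbb{F}}^k$, $z\in\overline{\mathbb{F}}^{k+1}$ at which the trilinear form $f(x,y,z)=\sum_{p,i,j}(M_p)_{ij}x_pz_iy_j$ and all its first partial derivatives vanish; for this format this is equivalent to the existence of nonzero $x\in\overline{\mathbb{F}}^2$, $y\in\overline{\mathbb{F}}^k$ with $(x_0M_0+x_1M_1)y=0$. Otherwise it is nondegenerate. $M_k(\mathbb{F})$ is the set of nondegenerate $2\times k\times(k+1)$ hypermatrices over $\mathbb{F}$, with the subspace topology from $\mathbb{F}^{2k(k+1)}$. The group $GL_k(\mathbb{F})\times GL_{k+1}(\mathbb{F})$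 acts on hypermatrices by simultaneous column and row operations on the two slices: $(A,B)\cdot(M_0,M_1)=(BM_0A^{T},BM_1A^{T})$. $N$ is the subgroup of $GL_k(\mathbb{F})\times GL_{k+1}(\mathbb{F})$ consisting of the pairs $(cI_k,c^{-1}I_{k+1})$, $c\in\mathbb{F}^\times$ (it acts trivially), and $G(\mathbb{F})=(GL_k(\mathbb{F})\times GL_{k+1}(\mathbb{F}))/N$ carries the quotient topology. *)

theory Defs
  imports
    "HOL-Analysis.Analysis"
    "HOL-Algebra.Group_Action"
    "HOL-Algebra.Algebraic_Closure_Type"
begin

text \<open>No separation axiom is required: a topological field is a field with a topology for which
  the field operations are continuous.\<close>

class topological_field = field + topological_ab_group_add + topological_semigroup_mult +
  assumes tendsto_inverse_nhds: "x \<noteq> 0 \<Longrightarrow> (inverse \<longlongrightarrow> inverse x) (at x)"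


section \<open>Hypermatrices and degeneracy\<close>

text \<open>With \<open>CARD('n) = k\<close> and \<open>CARD('m) = k + 1\<close>, a hypermatrix is a pair (indexed by the type \<open>2\<close>,
  whose elements are \<open>0\<close> and \<open>1\<close>) of matrices with rows indexed by \<open>'m\<close> and columns by \<open>'n\<close>. The
  topology supplied by the type class instance of \<open>vec\<close> is the product topology on the entries.\<close>

type_synonym ('a, 'n, 'm) hypermatrix = "(('a^'n)^'m)^2"

definition trilinear ::
    "('a::comm_semiring_1, 'n::finite, 'm::finite) hypermatrix \<Rightarrow> 'a^2 \<Rightarrow> 'a^'n \<Rightarrow> 'a^'m \<Rightarrow> 'a" where
  "trilinear M x y z =
     (\<Sum>p\<in>UNIV. \<Sum>i\<in>UNIV. \<Sum>j\<in>UNIV. M $ p $ i $ j * x $ p * z $ i * y $ j)"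

text \<open>Formal derivative at \<open>t = 0\<close> of the polynomial \<open>f(x + t u, y + t v, z + t w)\<close> in \<open>t\<close>. The
  partial derivatives are the cases where \<open>(u, v, w)\<close> is a standard basis vector.\<close>

definition deriv_along ::
    "('a::field, 'n::finite, 'm::finite) hypermatrix \<Rightarrow>
     'a^2 \<Rightarrow> 'a^'n \<Rightarrow> 'a^'m \<Rightarrow> 'a^2 \<Rightarrow> 'a^'n \<Rightarrow> 'a^'m \<Rightarrow> 'a" where
  "deriv_along M x y z u v w =
     poly (pderiv (trilinear (\<chi> p i j. [:M $ p $ i $ j:])
       (\<chi> p. [:x $ p, u $ p:]) (\<chi> j. [:y $ j, v $ j:]) (\<chi> i. [:z $ i, w $ i:]))) 0"

definition partial_x where
  "partial_x M x y z p = deriv_along M x y z (axis p 1) 0 0"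

definition partial_y where
  "partial_y M x y z j = deriv_along M x y z 0 (axis j 1) 0"

definition partial_z where
  "partial_z M x y z i = deriv_along M x y z 0 0 (axis i 1)"

definition to_ac_hypermatrix ::
    "('a::field, 'n::finite, 'm::finite) hypermatrix \<Rightarrow> ('a alg_closure, 'n, 'm) hypermatrix" where
  "to_ac_hypermatrix M = (\<chi> p i j. to_ac (M $ p $ i $ j))"

definition degenerate :: "('a::field, 'n::finite, 'm::finite) hypermatrix \<Rightarrow> bool" where
  "degenerate M \<longleftrightarrow>
     (\<exists>(x :: 'a alg_closure^2) (y :: 'a alg_closure^'n) (z :: 'a alg_closure^'m).
        x \<noteq> 0 \<and> y \<noteq> 0 \<and> z \<noteq> 0 \<and>
        trilinear (to_ac_hypermatrix M) x y z = 0 \<and>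
        (\<forall>p. partial_x (to_ac_hypermatrix M) x y z p = 0) \<and>
        (\<forall>j. partial_y (to_ac_hypermatrix M) x y z j = 0) \<and>
        (\<forall>i. partial_z (to_ac_hypermatrix M) x y z i = 0))"

definition nondegenerate_hypermatrices ::
    "('a::field, 'n::finite, 'm::finite) hypermatrix set" where
  "nondegenerate_hypermatrices = {M. \<not> degenerate M}"

lemma deriv_along_eq:
  "deriv_along M x y z u v w = trilinear M u y z + trilinear M x v z + trilinear M x y w"
proof -
  have pderiv_sum': "pderiv (sum g A) = (\<Sum>a\<in>A. pderiv (g a))"
    for g :: "'i \<Rightarrow> 'a poly" and A
    by (induction A rule: infinite_finite_induct) (auto simp: pderiv_add)
  show ?thesis
    unfolding deriv_along_def trilinear_def
    by (simp add: pderiv_sum' poly_sum pderiv_mult pderiv_pCons sum.distrib [symmetric]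
        algebra_simps)
qed

lemma sum_axis_mult: "(\<Sum>q\<in>UNIV. axis p (1::'a::comm_semiring_1) $ q * g q) = g (p :: 'p::finite)"
  by (simp add: axis_def if_distrib if_distribR cong: if_cong)

lemma partial_x_eq:
  "partial_x M x y z p = (\<Sum>i\<in>UNIV. \<Sum>j\<in>UNIV. M $ p $ i $ j * z $ i * y $ j)"
proof -
  have "partial_x M x y z p =
      (\<Sum>q\<in>UNIV. axis p 1 $ q * (\<Sum>i\<in>UNIV. \<Sum>j\<in>UNIV. M $ q $ i $ j * z $ i * y $ j))"
    by (simp add: partial_x_def deriv_along_eq trilinear_def sum_distrib_left mult_ac)
  then show ?thesis by (simp only: sum_axis_mult)
qed

lemma partial_y_eq:
  "partial_y M x y z j = (\<Sum>p\<in>UNIV. \<Sum>i\<in>UNIV. M $ p $ i $ j * x $ p * z $ i)"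
proof -
  have "partial_y M x y z j =
      (\<Sum>p\<in>UNIV. \<Sum>i\<in>UNIV. \<Sum>l\<in>UNIV. axis j 1 $ l * (M $ p $ i $ l * x $ p * z $ i))"
    by (simp add: partial_y_def deriv_along_eq trilinear_def mult_ac)
  then show ?thesis by (simp only: sum_axis_mult)
qed

lemma partial_z_eq:
  "partial_z M x y z i = (\<Sum>p\<in>UNIV. \<Sum>j\<in>UNIV. M $ p $ i $ j * x $ p * y $ j)"
proof -
  have "partial_z M x y z i =
      (\<Sum>p\<in>UNIV. \<Sum>l\<in>UNIV. axis i 1 $ l * (\<Sum>j\<in>UNIV. M $ p $ l $ j * x $ p * y $ j))"
    by (simp add: partial_z_def deriv_along_eq trilinear_def sum_distrib_left mult_ac)
  then show ?thesis by (simp only: sum_axis_mult)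
qed


section \<open>The group and its natural action\<close>

definition GL :: "('a::field^'n::finite^'n) monoid" where
  "GL = \<lparr>carrier = {A. invertible A}, monoid.mult = (**), one = mat 1\<rparr>"

definition GLprod :: "(('a::field^'n::finite^'n) \<times> ('a^'m::finite^'m)) monoid" where
  "GLprod = GL \<times>\<times> GL"

definition scalarN :: "(('a::field^'n::finite^'n) \<times> ('a^'m::finite^'m)) set" where
  "scalarN = {(mat c, mat (inverse c)) | c. c \<noteq> 0}"

definition Ggrp :: "(('a::field^'n::finite^'n) \<times> ('a^'m::finite^'m)) set monoid" where
  "Ggrp = GLprod Mod scalarN"

definition nat_act ::
    "('a::field^'n::finite^'n) \<times> ('a^'m::finite^'m) \<Rightarrow>
     ('a, 'n, 'm) hypermatrix \<Rightarrow> ('a, 'n, 'm) hypermatrix" where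
  "nat_act = (\<lambda>(A, B) M. \<chi> p. B ** (M $ p) ** transpose A)"


section \<open>Topologies\<close>

definition quotient_topology :: "'x topology \<Rightarrow> ('x \<Rightarrow> 'y) \<Rightarrow> 'y topology" where
  "quotient_topology T q =
     topology (\<lambda>U. U \<subseteq> q ` topspace T \<and> openin T {x \<in> topspace T. q x \<in> U})"

lemma openin_quotient_topology:
  "openin (quotient_topology T q) U \<longleftrightarrow>
     U \<subseteq> q ` topspace T \<and> openin T {x \<in> topspace T. q x \<in> U}"
proof -
  have "istopology (\<lambda>U. U \<subseteq> q ` topspace T \<and> openin T {x \<in> topspace T. q x \<in> U})"
    unfolding istopology_def
  proof (intro conjI allI impI)
    fix S V
    assume S: "S \<subseteq> q ` topspace T \<and> openin T {x \<in> topspace T. q x \<in> S}"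
      and V: "V \<subseteq> q ` topspace T \<and> openin T {x \<in> topspace T. q x \<in> V}"
    have "{x \<in> topspace T. q x \<in> S \<inter> V} =
        {x \<in> topspace T. q x \<in> S} \<inter> {x \<in> topspace T. q x \<in> V}" by auto
    with S V show "openin T {x \<in> topspace T. q x \<in> S \<inter> V}" by auto
    show "S \<inter> V \<subseteq> q ` topspace T" using S by auto
  next
    fix K
    assume K: "\<forall>S\<in>K. S \<subseteq> q ` topspace T \<and> openin T {x \<in> topspace T. q x \<in> S}"
    have "{x \<in> topspace T. q x \<in> \<Union>K} = (\<Union>S\<in>K. {x \<in> topspace T. q x \<in> S})" by auto
    with K show "openin T {x \<in> topspace T. q x \<in> \<Union>K}" by auto
    show "\<Union>K \<subseteq> q ` topspace T" using K by auto
  qed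
  then show ?thesis
    by (simp add: quotient_topology_def)
qed

lemma topspace_quotient_topology: "topspace (quotient_topology T q) = q ` topspace T"
proof (rule antisym)
  show "topspace (quotient_topology T q) \<subseteq> q ` topspace T"
    using openin_quotient_topology [of T q "topspace (quotient_topology T q)"] by simp
  have "{x \<in> topspace T. q x \<in> q ` topspace T} = topspace T" by auto
  then have "openin (quotient_topology T q) (q ` topspace T)"
    by (simp add: openin_quotient_topology)
  then show "q ` topspace T \<subseteq> topspace (quotient_topology T q)"
    by (rule openin_subset)
qed

lemma quotient_map_quotient_topology: "quotient_map T (quotient_topology T q) q"
  by (simp add: quotient_map_def topspace_quotient_topology openin_quotient_topology)

definition GLprod_topology ::
    "(('a::topological_field^'n::finite^'n) \<times> ('a^'m::finite^'m)) topology" where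
  "GLprod_topology = top_of_set (carrier GLprod)"

definition Ggrp_topology ::
    "(('a::topological_field^'n::finite^'n) \<times> ('a^'m::finite^'m)) set topology" where
  "Ggrp_topology = quotient_topology GLprod_topology (\<lambda>g. scalarN #>\<^bsub>GLprod\<^esub> g)"

end

theory Submission
  imports Defs
begin

text \<open>
  Write \<open>M\<^sub>0, M\<^sub>1\<close> for the slices of a hypermatrix, and call \<open>x\<^sub>0 M\<^sub>0 + x\<^sub>1 M\<^sub>1\<close> its pencil. By a count of linear
  conditions, a nonzero kernel vector of some nonzero member of the pencil can always be completed to
  a critical point of the trilinear form. So \<open>M\<close> is nondegenerate iff all nonzero members of its pencil
  over the algebraic closure are injective (\<open>degenerate_iff_not_pencil_injective\<close>). In this form the
  invariance under row and column operations is evident.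

  Transitivity is Kronecker's normal form for such pencils, obtained here without the general theory.
  Counting unknowns yields vectors \<open>v\<^sub>0, \<dots>, v\<^sub>k\<^sub>-\<^sub>1\<close>, not all zero, with \<open>M\<^sub>1 v\<^sub>i = M\<^sub>0 v\<^sub>i\<^sub>+\<^sub>1\<close> (\<open>chain_exists\<close>). Put
  \<open>w\<^sub>i = M\<^sub>0 v\<^sub>i\<close> for \<open>i < k\<close> and \<open>w\<^sub>k = M\<^sub>1 v\<^sub>k\<^sub>-\<^sub>1\<close>. A linear relation among the \<open>w\<^sub>i\<close> is a polynomial of degree at
  most \<open>k\<close>. Over the algebraic closure it splits into linear factors, and each factor \<open>t - l\<close> can be
  cancelled since \<open>M\<^sub>1 - l M\<^sub>0\<close> is injective (\<open>chain_relation\<close>). Hence the \<open>w\<^sub>i\<close> and the \<open>v\<^sub>i\<close> are bases, and with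
  respect to them \<open>M\<close> is the hypermatrix \<open>S\<close> with \<open>S\<^sub>0 e\<^sub>j = e\<^sub>j\<close> and \<open>S\<^sub>1 e\<^sub>j = e\<^sub>j\<^sub>+\<^sub>1\<close> (\<open>canonical_form\<close>). The bases
  themselves have entries in the ground field; the closure serves only to prove independence.

  Freeness: if \<open>(A, B)\<close> fixes \<open>S\<close>, comparing the entries of \<open>B S\<^sub>p\<close> and \<open>S\<^sub>p A\<^sup>-\<^sup>T\<close> shows that both \<open>A\<^sup>-\<^sup>T\<close> and \<open>B\<close> are
  the same scalar (\<open>toeplitz_scalar\<close>). So the stabilizer of \<open>S\<close> is \<open>N\<close>, and by transitivity and
  centrality of \<open>N\<close> every stabilizer is \<open>N\<close>.

  Continuity: the action of \<open>GL\<^sub>k \<times> GL\<^sub>k\<^sub>+\<^sub>1\<close> is polynomial in the entries. It remains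
  continuous on the quotient because the coset map is open, whence also its product with the identity
  of the space of hypermatrices is an open quotient map.
\<close>

(* Frees the notation for vector entries, which formal power series share. *)
no_notation fps_nth (infixl \<open>$\<close> 75)

section \<open>Degeneracy as a kernel condition\<close>

text \<open>Fewer equations than unknowns: padding the system with zero rows gives a square matrix with a
  vanishing row, which has no right inverse and hence has a kernel. The index set of the equations is
  arbitrary, so that the systems below can be indexed by whatever is natural for them.\<close>

lemma nonzero_solution:
  fixes a :: "'i \<Rightarrow> ('a::field)^('u::finite)"
  assumes "finite I" "card I < CARD('u)"
  obtains x where "x \<noteq> 0" "\<And>i. i \<in> I \<Longrightarrow> (\<Sum>u\<in>UNIV. a i $ u * x $ u) = 0"
proof -
  obtain f :: "'i \<Rightarrow> 'u" where f: "inj_on f I"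
    using card_le_inj[of I "UNIV :: 'u set"] assms by auto
  have "card (f ` I) < CARD('u)"
    using card_image[OF f] assms by simp
  then have "f ` I \<noteq> UNIV" by auto
  then obtain r where r: "r \<notin> f ` I" by blast
  define Q :: "'a^'u^'u" where
    "Q = (\<chi> r. if r \<in> f ` I then a (the_inv_into I f r) else 0)"
  have "\<nexists>B. B ** Q = mat 1"
  proof
    assume "\<exists>B. B ** Q = mat 1"
    then obtain B where "Q ** B = mat 1"
      using matrix_left_right_inverse by blast
    then have "(Q ** B) $ r $ r = 1"
      by (simp add: mat_def)
    with r show False
      by (simp add: matrix_matrix_mult_def Q_def)
  qed
  then obtain x where x: "Q *v x = 0" "x \<noteq> 0"
    unfolding matrix_left_invertible_ker by blast
  show thesis
  proof
    show "(\<Sum>u\<in>UNIV. a i $ u * x $ u) = 0" if "i \<in> I" for i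
    proof -
      have "(Q *v x) $ f i = 0" using x by simp
      with that f show ?thesis
        by (simp add: Q_def matrix_vector_mult_def the_inv_into_f_f)
    qed
  qed fact
qed

text \<open>The vector \<open>f(x, y, -)\<close>, that is, the matrix of the pencil at \<open>x\<close> applied to \<open>y\<close>. Both the
  trilinear form and all its partial derivatives are expressed through it.\<close>

definition contract ::
    "('a::field, 'n::finite, 'm::finite) hypermatrix \<Rightarrow> 'a^2 \<Rightarrow> 'a^'n \<Rightarrow> 'a^'m" where
  "contract M x y = (\<Sum>p\<in>UNIV. x $ p *s (M $ p *v y))"

lemma contract_nth:
  "contract M x y $ i = (\<Sum>p\<in>UNIV. \<Sum>j\<in>UNIV. M $ p $ i $ j * x $ p * y $ j)"
  by (simp add: contract_def matrix_vector_mult_def sum_distrib_left mult_ac)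

lemma contract_axis_left [simp]: "contract M (axis p 1) y = M $ p *v y"
  by (simp add: contract_def axis_def if_distrib if_distribR cong: if_cong)

lemma contract_expand_right:
  "contract M x y = (\<Sum>j\<in>UNIV. y $ j *s contract M x (axis j 1))"
proof -
  have "M $ p *v y = (\<Sum>j\<in>UNIV. y $ j *s (M $ p *v axis j 1))" for p
  proof -
    have "M $ p *v y = M $ p *v (\<Sum>j\<in>UNIV. y $ j *s axis j 1)"
      by (simp only: basis_expansion)
    then show ?thesis by (simp only: vec.sum vec.scale)
  qed
  then show ?thesis
    by (simp add: contract_def vec.scale_sum_right mult.commute) (rule sum.swap)
qed

text \<open>Over an algebraically closed field this is nondegeneracy in the \<open>2 \<times> k \<times> (k + 1)\<close>
  format. Over a general field it only sees the rational points of the pencil, so it is applied to the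
  extension of a hypermatrix to the algebraic closure.\<close>

definition pencil_injective ::
    "('a::field, 'n::finite, 'm::finite) hypermatrix \<Rightarrow> bool" where
  "pencil_injective M \<longleftrightarrow> (\<forall>x y. x \<noteq> 0 \<longrightarrow> y \<noteq> 0 \<longrightarrow> contract M x y \<noteq> 0)"

lemma partial_x_contract:
  "partial_x M x y z p = (\<Sum>i\<in>UNIV. contract M (axis p 1) y $ i * z $ i)"
  by (simp add: partial_x_eq matrix_vector_mult_def sum_distrib_left sum_distrib_right mult_ac)

lemma partial_y_contract:
  "partial_y M x y z j = (\<Sum>i\<in>UNIV. contract M x (axis j 1) $ i * z $ i)"
proof -
  have "contract M x (axis j 1) $ i = (\<Sum>p\<in>UNIV. M $ p $ i $ j * x $ p)" for i
    by (simp add: contract_nth axis_def if_distrib if_distribR cong: if_cong)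
  then show ?thesis
    by (simp add: partial_y_eq sum_distrib_right) (rule sum.swap)
qed

lemma partial_z_contract: "partial_z M x y z i = contract M x y $ i"
  by (simp add: partial_z_eq contract_nth)

lemma trilinear_contract: "trilinear M x y z = (\<Sum>i\<in>UNIV. contract M x y $ i * z $ i)"
proof -
  have "trilinear M x y z = (\<Sum>p\<in>UNIV. \<Sum>i\<in>UNIV. x $ p * ((M $ p *v y) $ i * z $ i))"
    by (simp add: trilinear_def matrix_vector_mult_def sum_distrib_right sum_distrib_left mult_ac)
  also have "\<dots> = (\<Sum>i\<in>UNIV. \<Sum>p\<in>UNIV. x $ p * ((M $ p *v y) $ i * z $ i))"
    by (rule sum.swap)
  finally show ?thesis by (simp add: contract_def sum_distrib_left sum_distrib_right mult_ac)
qed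

text \<open>Given a kernel vector \<open>y\<close> of the pencil at \<open>x\<close>, the critical point needs a third component \<open>z\<close>
  orthogonal to the \<open>k\<close> columns of the pencil at \<open>x\<close> and to the two vectors \<open>M\<^sub>0 y\<close>, \<open>M\<^sub>1 y\<close>. The relation
  \<open>f(x, y, -) = 0\<close> makes one of the columns a combination of the others, and one of the two vectors a
  multiple of the other. So \<open>(k - 1) + 1 = k\<close> conditions remain on the \<open>k + 1\<close> coordinates of \<open>z\<close>.\<close>

lemma conormal_exists:
  fixes M :: "('a::field, 'n::finite, 'm::finite) hypermatrix"
  assumes card: "CARD('m) = CARD('n) + 1"
    and "x \<noteq> 0" "y \<noteq> 0" and 0: "contract M x y = 0"
  obtains z where "z \<noteq> 0"
    "\<And>p. (\<Sum>i\<in>UNIV. contract M (axis p 1) y $ i * z $ i) = 0"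
    "\<And>j. (\<Sum>i\<in>UNIV. contract M x (axis j 1) $ i * z $ i) = 0"
proof -
  obtain p0 where p0: "x $ p0 \<noteq> 0" using \<open>x \<noteq> 0\<close> by (auto simp: vec_eq_iff)
  obtain j0 where j0: "y $ j0 \<noteq> 0" using \<open>y \<noteq> 0\<close> by (auto simp: vec_eq_iff)
  let ?I = "Sum_Type.Plus (UNIV - {p0}) (UNIV - {j0})"
  define a where "a = case_sum (\<lambda>p. contract M (axis p 1) y) (\<lambda>j. contract M x (axis j 1))"
  have "finite ?I" "card ?I < CARD('m)"
    by (simp_all add: card_Plus card card_Diff_subset)
  then obtain z where "z \<noteq> 0" and z: "\<And>i. i \<in> ?I \<Longrightarrow> (\<Sum>u\<in>UNIV. a i $ u * z $ u) = 0"
    using nonzero_solution[of ?I a] by blast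
  define f where "f p = (\<Sum>i\<in>UNIV. contract M (axis p 1) y $ i * z $ i)" for p
  define g where "g j = (\<Sum>i\<in>UNIV. contract M x (axis j 1) $ i * z $ i)" for j
  have f: "f p = 0" if "p \<noteq> p0" for p
    using z[OF InlI, of p] that by (simp add: a_def f_def)
  have g: "g j = 0" if "j \<noteq> j0" for j
    using z[OF InrI, of j] that by (simp add: a_def g_def)
  \<comment> \<open>The omitted equations, at \<open>p0\<close> and \<open>j0\<close>, follow from the others.\<close>
  have "0 = (\<Sum>i\<in>UNIV. contract M x y $ i * z $ i)" using 0 by simp
  also have "\<dots> = (\<Sum>p\<in>UNIV. x $ p * f p)"
    by (simp add: f_def contract_def[of M x y] sum_distrib_left sum_distrib_right mult_ac)
       (rule sum.swap)
  also have "\<dots> = x $ p0 * f p0"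
    using f by (subst sum.remove[of _ p0]) auto
  finally have "f p0 = 0" using p0 by simp
  have "0 = (\<Sum>i\<in>UNIV. contract M x y $ i * z $ i)" using 0 by simp
  also have "\<dots> = (\<Sum>j\<in>UNIV. y $ j * g j)"
    by (subst contract_expand_right)
       (simp add: g_def sum_distrib_left sum_distrib_right mult_ac, rule sum.swap)
  also have "\<dots> = y $ j0 * g j0"
    using g by (subst sum.remove[of _ j0]) auto
  finally have "g j0 = 0" using j0 by simp
  show thesis
  proof (rule that)
    show "z \<noteq> 0" by fact
    show "(\<Sum>i\<in>UNIV. contract M (axis p 1) y $ i * z $ i) = 0" for p
      using f[of p] \<open>f p0 = 0\<close> unfolding f_def by (cases "p = p0") auto
    show "(\<Sum>i\<in>UNIV. contract M x (axis j 1) $ i * z $ i) = 0" for j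
      using g[of j] \<open>g j0 = 0\<close> unfolding g_def by (cases "j = j0") auto
  qed
qed

lemma degenerate_iff_not_pencil_injective:
  fixes M :: "('a::field, 'n::finite, 'm::finite) hypermatrix"
  assumes "CARD('m) = CARD('n) + 1"
  shows "degenerate M \<longleftrightarrow> \<not> pencil_injective (to_ac_hypermatrix M)"
proof
  assume "degenerate M"
  then show "\<not> pencil_injective (to_ac_hypermatrix M)"
    unfolding degenerate_def pencil_injective_def partial_z_contract vec_eq_iff zero_index
    by blast
next
  assume "\<not> pencil_injective (to_ac_hypermatrix M)"
  then obtain x y where xy: "x \<noteq> 0" "y \<noteq> 0" "contract (to_ac_hypermatrix M) x y = 0"
    unfolding pencil_injective_def by blast
  obtain z where "z \<noteq> 0"
    "\<And>p. partial_x (to_ac_hypermatrix M) x y z p = 0"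
    "\<And>j. partial_y (to_ac_hypermatrix M) x y z j = 0"
    unfolding partial_x_contract partial_y_contract
    using conormal_exists[OF assms xy] by blast
  moreover from xy have "trilinear (to_ac_hypermatrix M) x y z = 0"
    "\<And>i. partial_z (to_ac_hypermatrix M) x y z i = 0"
    by (simp_all add: partial_z_contract trilinear_contract)
  ultimately show "degenerate M"
    unfolding degenerate_def using xy by blast
qed

section \<open>Enumerated indices and the standard hypermatrix\<close>

text \<open>The normal form shifts indices by one, from the columns to the rows. Since row and column indices
  live in unrelated finite types, both are numbered from zero.\<close>

definition idx :: "'x::finite \<Rightarrow> nat" where
  "idx = (SOME f. bij_betw f UNIV {..<CARD('x)})"

definition elt :: "nat \<Rightarrow> 'x::finite" where
  "elt = inv_into UNIV idx"

lemma bij_idx: "bij_betw (idx :: 'x::finite \<Rightarrow> nat) UNIV {..<CARD('x)}"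
  unfolding idx_def
  by (rule someI_ex[OF ex_bij_betw_finite_nat[OF finite], unfolded atLeast0LessThan])

lemma idx_less: "idx (i :: 'x::finite) < CARD('x)"
  using bij_betw_apply[OF bij_idx] by auto

lemma idx_elt [simp]: "i < CARD('x) \<Longrightarrow> idx (elt i :: 'x::finite) = i"
  unfolding elt_def using bij_betw_inv_into_right[OF bij_idx] by simp

lemma elt_idx [simp]: "elt (idx i) = (i :: 'x::finite)"
  unfolding elt_def using bij_betw_inv_into_left[OF bij_idx] by simp

lemma idx_eq_iff [simp]: "idx i = idx j \<longleftrightarrow> i = (j :: 'x::finite)"
  using bij_betw_imp_inj_on[OF bij_idx] by (rule inj_eq)

lemma idx_eq_iff_elt:
  "l = idx (j :: 'x::finite) \<longleftrightarrow> l < CARD('x) \<and> j = elt l"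
  "idx (j :: 'x::finite) = l \<longleftrightarrow> l < CARD('x) \<and> j = elt l"
  using idx_less[of j] by auto

lemma sum_idx: "(\<Sum>i\<in>UNIV. g (idx (i :: 'x::finite))) = (\<Sum>i<CARD('x). g i)"
  by (rule sum.reindex_bij_betw[OF bij_idx])

lemma sum_elt: "(\<Sum>i\<in>UNIV. g (i :: 'x::finite)) = (\<Sum>i<CARD('x). g (elt i))"
  using sum_idx[of "\<lambda>i. g (elt i)", where 'x = 'x] by simp

text \<open>The slices are the identity matrix with a zero row appended below, respectively above: they send
  the basis vector \<open>e\<^sub>j\<close> to \<open>e\<^sub>j\<close> and to \<open>e\<^sub>j\<^sub>+\<^sub>1\<close>. This is Kronecker's block with left minimal index \<open>k\<close>.\<close>

definition standard_hypermatrix :: "('a::field, 'n::finite, 'm::finite) hypermatrix" where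
  "standard_hypermatrix = (\<chi> p i j. if idx i = idx j + (if p = 0 then 0 else 1) then 1 else 0)"

lemma type_2_cases: "(p :: 2) = 0 \<or> p = 1"
  using exhaust_2[of p] by auto

lemma sum_type_2: "(\<Sum>p\<in>UNIV. g (p :: 2)) = g 0 + g 1"
  \<comment> \<open>In the type \<open>2\<close> the numeral 2 is 0.\<close>
  using arg_cong[of 2 0 g] by (simp add: sum_2 add.commute)

section \<open>Reduction to the standard hypermatrix\<close>

text \<open>The unknowns are the \<open>k \<cdot> k\<close> coordinates of \<open>v\<^sub>0, \<dots>, v\<^sub>k\<^sub>-\<^sub>1\<close>, and the \<open>k - 1\<close> vector equations amount to
  \<open>(k - 1)(k + 1) = k\<^sup>2 - 1\<close> scalar ones. In the coordinates of the standard hypermatrix the basis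
  vectors form such a chain.\<close>

lemma chain_exists:
  fixes M :: "('a::field, 'n::finite, 'm::finite) hypermatrix"
  assumes card: "CARD('m) = CARD('n) + 1"
  obtains v :: "nat \<Rightarrow> 'a^'n"
  where "\<exists>i<CARD('n). v i \<noteq> 0"
    and "\<And>i. Suc i < CARD('n) \<Longrightarrow> M $ 1 *v v i = M $ 0 *v v (Suc i)"
proof -
  define k where "k = CARD('n)"
  have "k \<ge> 1" by (simp add: k_def Suc_leI)
  let ?I = "{..<k - 1} \<times> (UNIV :: 'm set)"
  define a :: "nat \<times> 'm \<Rightarrow> 'a^('n \<times> 'n)" where
    "a = (\<lambda>(i, r). \<chi> u. (if fst u = elt i then M $ 1 $ r $ snd u else 0) -
                        (if fst u = elt (Suc i) then M $ 0 $ r $ snd u else 0))"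
  have "card ?I = (k - 1) * (k + 1)" by (simp add: card k_def)
  also have "\<dots> < k * k" using \<open>k \<ge> 1\<close> by (cases k) auto
  also have "\<dots> = CARD('n \<times> 'n)" by (simp add: k_def)
  finally have "card ?I < CARD('n \<times> 'n)" .
  moreover have "finite ?I" by simp
  ultimately obtain x where "x \<noteq> 0" and x: "\<And>i. i \<in> ?I \<Longrightarrow> (\<Sum>u\<in>UNIV. a i $ u * x $ u) = 0"
    using nonzero_solution[of ?I a] by blast
  define v where "v i = (\<chi> j. x $ (elt i, j))" for i
  have "\<exists>i<k. v i \<noteq> 0"
  proof -
    obtain l j where "x $ (l, j) \<noteq> 0" using \<open>x \<noteq> 0\<close> by (auto simp: vec_eq_iff)
    then have "v (idx l) $ j \<noteq> 0" by (simp add: v_def)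
    then show ?thesis using idx_less[of l] by (auto simp: k_def vec_eq_iff)
  qed
  moreover have "M $ 1 *v v i = M $ 0 *v v (Suc i)" if "Suc i < k" for i
  proof -
    have "(M $ 1 *v v i) $ r - (M $ 0 *v v (Suc i)) $ r = 0" for r
    proof -
      have "(i, r) \<in> ?I" using that by auto
      then have "0 = (\<Sum>u\<in>UNIV \<times> UNIV. a (i, r) $ u * x $ u)"
        using x by simp
      also have "\<dots> = (\<Sum>l\<in>UNIV. \<Sum>j\<in>UNIV. a (i, r) $ (l, j) * x $ (l, j))"
        by (simp only: sum.cartesian_product split_def prod.collapse)
      also have "\<dots> = (\<Sum>l\<in>(UNIV :: 'n set). (if l = elt i then (M $ 1 *v v i) $ r else 0)
                      - (if l = elt (Suc i) then (M $ 0 *v v (Suc i)) $ r else 0))"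
        by (rule sum.cong)
           (auto simp: a_def matrix_vector_mult_def v_def sum_subtractf left_diff_distrib)
      also have "\<dots> = (M $ 1 *v v i) $ r - (M $ 0 *v v (Suc i)) $ r"
        by (simp add: sum_subtractf)
      finally show ?thesis by simp
    qed
    then show ?thesis by (simp add: vec_eq_iff)
  qed
  ultimately show thesis using that unfolding k_def by blast
qed

lemma pencil_injectiveD:
  assumes "pencil_injective M" "c *s (M $ 0 *v y) + d *s (M $ 1 *v y) = 0" "c \<noteq> 0 \<or> d \<noteq> 0"
  shows "y = 0"
proof (rule ccontr)
  assume "y \<noteq> 0"
  define x :: "'a^2" where "x = (\<chi> p. if p = 0 then c else d)"
  have "x $ 0 = c" "x $ 1 = d" by (simp_all add: x_def)
  moreover from this have "x \<noteq> 0" using assms(3) by auto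
  ultimately show False
    using assms(1,2) \<open>y \<noteq> 0\<close> by (auto simp: pencil_injective_def contract_def sum_type_2)
qed

text \<open>A linear relation \<open>\<Sum> c\<^sub>i w\<^sub>i = 0\<close> is read as a polynomial \<open>c\<close>. Since \<open>M\<^sub>0\<close> sends \<open>v\<^sub>i\<close> to \<open>w\<^sub>i\<close> and \<open>M\<^sub>1\<close> sends it
  to \<open>w\<^sub>i\<^sub>+\<^sub>1\<close>, multiplication by the linear factor \<open>t - l\<close> corresponds to the map \<open>M\<^sub>1 - l M\<^sub>0\<close>. If \<open>c = (t - l) b\<close>,
  this map kills \<open>\<Sum> b\<^sub>i v\<^sub>i\<close>; it is injective, and so \<open>b\<close> is again a relation. Splitting off all roots
  leaves a nonzero constant relation, which says that \<open>w\<^sub>0\<close> vanishes.\<close>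

lemma chain_relation:
  fixes M :: "('a::alg_closed_field, 'n::finite, 'm::finite) hypermatrix"
  assumes inj: "pencil_injective M"
    and v0: "\<And>i. i < k \<Longrightarrow> M $ 0 *v v i = w i"
    and v1: "\<And>i. i < k \<Longrightarrow> M $ 1 *v v i = w (Suc i)"
    and "c \<noteq> 0" "Polynomial.degree c \<le> k" "(\<Sum>i\<le>k. Polynomial.coeff c i *s w i) = 0"
  shows "w 0 = 0"
  using assms(4-6)
proof (induction "Polynomial.degree c" arbitrary: c)
  case 0
  then obtain a where c: "c = [:a:]" by (metis degree_eq_zeroE)
  have "0 = (\<Sum>i\<le>k. Polynomial.coeff c i *s w i)" using 0 by simp
  also have "\<dots> = (\<Sum>i\<in>{0}. Polynomial.coeff c i *s w i)"
    by (rule sum.mono_neutral_right) (auto simp: c coeff_pCons split: nat.splits)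
  finally show ?case using c 0 by auto
next
  case (Suc d)
  then obtain l where "poly c l = 0" using alg_closed_imp_poly_has_root[of c] by auto
  then obtain b where c: "c = [:- l, 1:] * b" by (metis dvdE poly_eq_0_iff_dvd)
  with Suc have "b \<noteq> 0" by auto
  then have deg: "Polynomial.degree b = d" using Suc(2) unfolding c by (subst (asm) degree_mult_eq) auto
  then have "d < k" using Suc by simp
  define y where "y = (\<Sum>i<k. Polynomial.coeff b i *s v i)"
  have bk: "Polynomial.coeff b k = 0" using \<open>d < k\<close> deg by (simp add: coeff_eq_0)
  have y0: "M $ 0 *v y = (\<Sum>i<k. Polynomial.coeff b i *s w i)"
    by (simp add: y_def vec.sum vec.scale v0)
  have y1: "M $ 1 *v y = (\<Sum>i<k. Polynomial.coeff b i *s w (Suc i))"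
    by (simp add: y_def vec.sum vec.scale v1)
  have "Polynomial.coeff c i = (if i = 0 then 0 else Polynomial.coeff b (i - 1)) - l * Polynomial.coeff b i" for i
    by (cases i) (simp_all add: c)
  then have "(\<Sum>i\<le>k. Polynomial.coeff c i *s w i) =
      (\<Sum>i\<le>k. (if i = 0 then 0 else Polynomial.coeff b (i - 1)) *s w i) - (\<Sum>i\<le>k. l *s (Polynomial.coeff b i *s w i))"
    by (simp add: vec.scale_left_diff_distrib sum_subtractf)
  also have "(\<Sum>i\<le>k. (if i = 0 then 0 else Polynomial.coeff b (i - 1)) *s w i) = M $ 1 *v y"
    unfolding y1 lessThan_Suc_atMost[symmetric] by (subst sum.lessThan_Suc_shift) simp
  also have "(\<Sum>i\<le>k. l *s (Polynomial.coeff b i *s w i)) = l *s (M $ 0 *v y)"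
    unfolding y0 lessThan_Suc_atMost[symmetric] by (simp add: bk vec.scale_sum_right)
  finally have "(- l) *s (M $ 0 *v y) + 1 *s (M $ 1 *v y) = 0"
    using Suc by simp
  then have "y = 0" by (rule pencil_injectiveD[OF inj]) simp
  then have "(\<Sum>i\<le>k. Polynomial.coeff b i *s w i) = 0"
    using y0 unfolding lessThan_Suc_atMost[symmetric] by (simp add: bk)
  then show ?case using Suc(1)[of b] deg \<open>b \<noteq> 0\<close> \<open>d < k\<close> by simp
qed


definition ac_vec :: "'a::field^'n \<Rightarrow> 'a alg_closure^'n" where
  "ac_vec v = (\<chi> i. to_ac (v $ i))"

definition ac_mat :: "'a::field^'n^'m \<Rightarrow> 'a alg_closure^'n^'m" where
  "ac_mat A = (\<chi> i j. to_ac (A $ i $ j))"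

lemma ac_mat_vec: "ac_mat A *v ac_vec v = ac_vec (A *v v)"
  by (simp add: ac_mat_def ac_vec_def matrix_vector_mult_def vec_eq_iff to_ac_sum)

lemma ac_mat_mat: "ac_mat (A ** B) = ac_mat A ** ac_mat B"
  by (simp add: ac_mat_def matrix_matrix_mult_def vec_eq_iff to_ac_sum)

lemma ac_mat_1: "ac_mat (mat 1) = mat 1"
  by (simp add: ac_mat_def mat_def vec_eq_iff)

lemma ac_vec_eq_0_iff [simp]: "ac_vec v = 0 \<longleftrightarrow> v = 0"
  by (simp add: ac_vec_def vec_eq_iff)

lemma to_ac_hypermatrix_nth: "to_ac_hypermatrix M $ p = ac_mat (M $ p)"
  by (simp add: to_ac_hypermatrix_def ac_mat_def vec_eq_iff)

text \<open>A nontrivial relation forces \<open>w\<^sub>0 = 0\<close>. Then \<open>v\<^sub>0 = 0\<close> by injectivity of \<open>M\<^sub>0\<close>, hence \<open>w\<^sub>1 = M\<^sub>1 v\<^sub>0 = 0\<close>, and so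
  on along the chain, so that all \<open>v\<^sub>i\<close> vanish.\<close>

lemma chain_independent:
  fixes M :: "('a::field, 'n::finite, 'm::finite) hypermatrix"
  assumes inj: "pencil_injective (to_ac_hypermatrix M)"
    and v0: "\<And>i. i < k \<Longrightarrow> M $ 0 *v v i = w i"
    and v1: "\<And>i. i < k \<Longrightarrow> M $ 1 *v v i = w (Suc i)"
    and nz: "\<exists>i<k. v i \<noteq> 0"
    and rel: "(\<Sum>i\<le>k. c i *s w i) = 0" and "i \<le> k"
  shows "c i = 0"
proof (rule ccontr)
  assume "c i \<noteq> 0"
  let ?M = "to_ac_hypermatrix M"
  define p where "p = (\<Sum>i\<le>k. Polynomial.monom (to_ac (c i)) i)"
  have coeff: "Polynomial.coeff p j = (if j \<le> k then to_ac (c j) else 0)" for j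
    by (auto simp: p_def coeff_sum)
  have "p \<noteq> 0" using coeff[of i] \<open>c i \<noteq> 0\<close> \<open>i \<le> k\<close> by auto
  have "Polynomial.degree p \<le> k" by (rule degree_le) (simp add: coeff)
  have "(\<Sum>i\<le>k. Polynomial.coeff p i *s ac_vec (w i)) = ac_vec (\<Sum>i\<le>k. c i *s w i)"
    by (simp add: vec_eq_iff ac_vec_def coeff to_ac_sum)
  then have "(\<Sum>i\<le>k. Polynomial.coeff p i *s ac_vec (w i)) = 0"
    using rel by simp
  with \<open>p \<noteq> 0\<close> \<open>Polynomial.degree p \<le> k\<close> have "ac_vec (w 0) = 0"
    by (rule chain_relation[OF inj, of k "\<lambda>i. ac_vec (v i)", rotated 2])
       (simp_all add: to_ac_hypermatrix_nth ac_mat_vec v0 v1)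
  then have "w 0 = 0" by simp
  have step: "v j = 0" if "j < k" "w j = 0" for j
  proof -
    have "ac_vec (v j) = 0"
      by (rule pencil_injectiveD[OF inj, of 1 _ 0])
         (use that in \<open>simp_all add: to_ac_hypermatrix_nth ac_mat_vec v0\<close>)
    then show ?thesis by simp
  qed
  have "j < k \<Longrightarrow> v j = 0 \<and> w j = 0" for j
  proof (induction j)
    case 0
    then show ?case using \<open>w 0 = 0\<close> step by simp
  next
    case (Suc j)
    then have "w (Suc j) = 0" using v1[of j] by simp
    with Suc show ?case using step by simp
  qed
  with nz show False by auto
qed

lemma invertible_transpose: "invertible (A :: 'a::field^'n^'n) \<Longrightarrow> invertible (transpose A)"
  unfolding invertible_def by (metis matrix_transpose_mul transpose_mat)

lemma mult_columns: "(\<chi> r s. w (idx s) $ r) *v x = (\<Sum>i<CARD('n). x $ elt i *s w i)"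
  for w :: "nat \<Rightarrow> 'a::field^'m" and x :: "'a^'n"
  using sum_elt[of "\<lambda>s. x $ s *s w (idx s)"]
  by (simp add: vec_eq_iff matrix_vector_mult_def mult.commute)

text \<open>The \<open>k + 1\<close> vectors \<open>w\<^sub>i\<close> form a basis, and then so do the \<open>k\<close> vectors \<open>v\<^sub>i\<close>, because \<open>M\<^sub>0\<close> sends a relation
  among them to a relation among the \<open>w\<^sub>i\<close>. In these two bases \<open>M\<close> is standard: with \<open>V\<close> and \<open>W\<close> the
  matrices of the bases, \<open>M\<^sub>p V = W S\<^sub>p\<close>.\<close>

lemma canonical_form:
  fixes M :: "('a::field, 'n::finite, 'm::finite) hypermatrix"
  assumes card: "CARD('m) = CARD('n) + 1"
    and inj: "pencil_injective (to_ac_hypermatrix M)"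
  obtains A B where "invertible A" "invertible B" "M = nat_act (A, B) standard_hypermatrix"
proof -
  define k where "k = CARD('n)"
  obtain v :: "nat \<Rightarrow> 'a^'n" where nz: "\<exists>i<k. v i \<noteq> 0"
    and v: "\<And>i. Suc i < k \<Longrightarrow> M $ 1 *v v i = M $ 0 *v v (Suc i)"
    using chain_exists[OF card] unfolding k_def by blast
  define w where "w i = (if i < k then M $ 0 *v v i else M $ 1 *v v (k - 1))" for i
  have v0: "M $ 0 *v v i = w i" if "i < k" for i
    using that by (simp add: w_def)
  have v1: "M $ 1 *v v i = w (Suc i)" if "i < k" for i
  proof (cases "Suc i < k")
    case False
    with that have "i = k - 1" by simp
    with False show ?thesis by (simp add: w_def)
  qed (simp add: w_def v)
  have independent: "c i = 0" if "(\<Sum>i\<le>k. c i *s w i) = 0" "i \<le> k" for c i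
    using v0 v1 nz that by (rule chain_independent[OF inj])
  define W :: "'a^'m^'m" where "W = (\<chi> r s. w (idx s) $ r)"
  define V :: "'a^'n^'n" where "V = (\<chi> r s. v (idx s) $ r)"
  have "x = 0" if "W *v x = 0" for x
  proof -
    have "(\<Sum>i\<le>k. x $ elt i *s w i) = 0"
      using that by (simp add: W_def mult_columns card k_def lessThan_Suc_atMost)
    then have *: "x $ elt i = 0" if "i \<le> k" for i
      using independent[of "\<lambda>i. x $ elt i" i] that by simp
    have "x $ s = 0" for s
      using *[of "idx s"] idx_less[of s] by (simp add: card k_def)
    then show ?thesis by (simp add: vec_eq_iff)
  qed
  then have "invertible W"
    by (simp add: invertible_left_inverse matrix_left_invertible_ker)
  have "x = 0" if "V *v x = 0" for x
  proof -
    have "0 = M $ 0 *v (\<Sum>i<k. x $ elt i *s v i)"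
      using that by (simp add: V_def mult_columns k_def)
    also have "\<dots> = (\<Sum>i<k. x $ elt i *s w i)"
      by (simp add: vec.sum vec.scale v0)
    also have "\<dots> = (\<Sum>i\<le>k. (if i < k then x $ elt i else 0) *s w i)"
      by (simp flip: lessThan_Suc_atMost)
    finally have "(\<Sum>i\<le>k. (if i < k then x $ elt i else 0) *s w i) = 0" by simp
    then have *: "x $ elt i = 0" if "i < k" for i
      using independent[of "\<lambda>i. if i < k then x $ elt i else 0" i] that by simp
    have "x $ s = 0" for s
      using *[of "idx s"] idx_less[of s] by (simp add: k_def)
    then show ?thesis by (simp add: vec_eq_iff)
  qed
  then have "\<exists>V'. V' ** V = mat 1"
    by (simp add: matrix_left_invertible_ker)
  then obtain V' where V': "V' ** V = mat 1" by blast
  then have V'': "V ** V' = mat 1" by (simp add: matrix_left_right_inverse)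
  have MV: "M $ p ** V = W ** standard_hypermatrix $ p" for p
  proof -
    have "(M $ p ** V) $ r $ s = (W ** standard_hypermatrix $ p) $ r $ s" for r s
    proof -
      define d where "d = (if p = 0 then 0 else 1 :: nat)"
      have less: "idx s + d < CARD('m)"
        using idx_less[of s] by (simp add: card d_def)
      have standard_nth: "(standard_hypermatrix :: ('a, 'n, 'm) hypermatrix) $ p $ t $ s =
          (if t = elt (idx s + d) then 1 else 0)" for t
        using less idx_eq_iff_elt(2)[of t "idx s + d"]
        by (simp add: standard_hypermatrix_def d_def)
      have "(M $ p ** V) $ r $ s = (M $ p *v v (idx s)) $ r"
        by (simp add: matrix_matrix_mult_def matrix_vector_mult_def V_def)
      also have "M $ p *v v (idx s) = w (idx s + d)"
        using type_2_cases[of p] v0[of "idx s"] v1[of "idx s"] idx_less[of s]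
        by (auto simp: d_def k_def)
      also have "w (idx s + d) $ r = (\<Sum>t\<in>UNIV. W $ r $ t * (if t = elt (idx s + d) then 1 else 0))"
        using less by (simp add: W_def if_distrib cong: if_cong)
      also have "\<dots> = (W ** standard_hypermatrix $ p) $ r $ s"
        by (simp add: matrix_matrix_mult_def standard_nth)
      finally show ?thesis .
    qed
    then show ?thesis by (simp add: vec_eq_iff)
  qed
  have "M $ p = W ** standard_hypermatrix $ p ** V'" for p
    by (simp only: MV[symmetric] matrix_mul_assoc[symmetric] V'' matrix_mul_rid)
  then have "M = nat_act (transpose V', W) standard_hypermatrix"
    by (simp add: nat_act_def vec_eq_iff)
  moreover have "invertible (transpose V')"
    by (rule invertible_transpose) (use V' V'' in \<open>auto simp: invertible_def\<close>)
  ultimately show thesis using that \<open>invertible W\<close> by blast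
qed

section \<open>Nondegeneracy and stabilizer of the standard hypermatrix\<close>

lemma standard_slice_0:
  "(standard_hypermatrix :: ('a::field, 'n::finite, 'm::finite) hypermatrix) $ 0 $ r $ j =
     (if idx r = idx j then 1 else 0)"
  by (simp add: standard_hypermatrix_def)

lemma standard_slice_1:
  "(standard_hypermatrix :: ('a::field, 'n::finite, 'm::finite) hypermatrix) $ 1 $ r $ j =
     (if idx r = Suc (idx j) then 1 else 0)"
  by (simp add: standard_hypermatrix_def)

lemma sum_delta_idx:
  "(\<Sum>j\<in>UNIV. if l = idx (j :: 'n::finite) then (g j :: 'a::field) else 0) =
     (if l < CARD('n) then g (elt l) else 0)"
  by (cases "l < CARD('n)") (simp_all add: idx_eq_iff_elt)

lemma sum_delta_Suc_idx:
  "(\<Sum>j\<in>UNIV. if l = Suc (idx (j :: 'n::finite)) then (g j :: 'a::field) else 0) =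
     (if 0 < l \<and> l - 1 < CARD('n) then g (elt (l - 1)) else 0)"
proof (cases l)
  case (Suc l')
  then show ?thesis using sum_delta_idx[of l' g] by simp
qed simp

lemma standard_pencil_injective:
  assumes card: "CARD('m) = CARD('n) + 1"
  shows "pencil_injective (standard_hypermatrix :: ('a::field, 'n::finite, 'm::finite) hypermatrix)"
  unfolding pencil_injective_def
proof (intro allI impI notI)
  let ?S = "standard_hypermatrix :: ('a, 'n, 'm) hypermatrix"
  fix x :: "'a^2" and y :: "'a^'n"
  assume "x \<noteq> 0" "y \<noteq> 0" and 0: "contract ?S x y = 0"
  have 1: "x $ 0 * (if i < CARD('n) then y $ elt i else 0) +
      x $ 1 * (if 0 < i \<and> i - 1 < CARD('n) then y $ elt (i - 1) else 0) = 0"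
    if "i \<le> CARD('n)" for i
  proof -
    have i: "idx (elt i :: 'm) = i" using that by (simp add: card)
    have "(?S $ 0 *v y) $ (elt i :: 'm) = (\<Sum>j\<in>UNIV. if i = idx j then y $ j else 0)"
      by (simp add: matrix_vector_mult_def standard_slice_0 i if_distribR if_distrib cong: if_cong)
    moreover have "(?S $ 1 *v y) $ (elt i :: 'm) = (\<Sum>j\<in>UNIV. if i = Suc (idx j) then y $ j else 0)"
      by (simp add: matrix_vector_mult_def standard_slice_1 i if_distribR if_distrib cong: if_cong)
    moreover have "contract ?S x y $ (elt i :: 'm) = 0" using 0 by simp
    ultimately show ?thesis
      by (simp only: contract_def sum_type_2 sum_delta_idx sum_delta_Suc_idx
          vector_add_component vector_smult_component)
  qed
  \<comment> \<open>Coordinate \<open>i\<close> of the contraction is \<open>x\<^sub>0 y\<^sub>i + x\<^sub>1 y\<^sub>i\<^sub>-\<^sub>1\<close>, with out-of-range terms zero.\<close>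
  have "y $ elt i = 0" if "i < CARD('n)" for i
  proof (cases "x $ 0 = 0")
    case True
    have "x $ 1 \<noteq> 0"
    proof
      assume "x $ 1 = 0"
      with True have "x $ p = 0" for p using type_2_cases[of p] by auto
      with \<open>x \<noteq> 0\<close> show False by (simp add: vec_eq_iff)
    qed
    then show ?thesis using 1[of "Suc i"] True that by simp
  next
    case False
    show ?thesis using that
    proof (induction i)
      case 0
      then show ?case using 1[of 0] False by simp
    next
      case (Suc i)
      then show ?case using 1[of "Suc i"] False by simp
    qed
  qed
  then have "y $ j = 0" for j using idx_less[of j] by (metis elt_idx)
  with \<open>y \<noteq> 0\<close> show False by (simp add: vec_eq_iff)
qed

lemma to_ac_standard: "to_ac_hypermatrix standard_hypermatrix = standard_hypermatrix"
  by (simp add: to_ac_hypermatrix_def standard_hypermatrix_def vec_eq_iff)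

lemma invertible_ker: "invertible A \<Longrightarrow> A *v y = 0 \<Longrightarrow> y = 0" for A :: "'a::field^'n^'n"
  unfolding invertible_left_inverse matrix_left_invertible_ker by blast

lemma invertible_ac_mat: "invertible A \<Longrightarrow> invertible (ac_mat A)"
  unfolding invertible_def by (metis ac_mat_mat ac_mat_1)

lemma contract_nat_act:
  "contract (to_ac_hypermatrix (nat_act (A, B) M)) x y =
     ac_mat B *v contract (to_ac_hypermatrix M) x (ac_mat (transpose A) *v y)"
  by (simp add: contract_def to_ac_hypermatrix_nth nat_act_def ac_mat_mat vec.sum vec.scale
      matrix_vector_mul_assoc matrix_mul_assoc)

lemma pencil_injective_nat_act:
  assumes "invertible A" "invertible B" "pencil_injective (to_ac_hypermatrix M)"
  shows "pencil_injective (to_ac_hypermatrix (nat_act (A, B) M))"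
  unfolding pencil_injective_def contract_nat_act
proof (intro allI impI notI)
  fix x y
  assume "x \<noteq> 0" "y \<noteq> 0"
    and 0: "ac_mat B *v contract (to_ac_hypermatrix M) x (ac_mat (transpose A) *v y) = 0"
  have "ac_mat (transpose A) *v y \<noteq> 0"
    using invertible_ker[OF invertible_ac_mat[OF invertible_transpose[OF assms(1)]]] \<open>y \<noteq> 0\<close>
    by blast
  moreover have "contract (to_ac_hypermatrix M) x (ac_mat (transpose A) *v y) = 0"
    using invertible_ker[OF invertible_ac_mat[OF assms(2)] 0] .
  ultimately show False
    using assms(3) \<open>x \<noteq> 0\<close> unfolding pencil_injective_def by blast
qed

text \<open>This is the equation \<open>B S\<^sub>p = S\<^sub>p C\<close> in coordinates, for \<open>B\<close> of size \<open>k + 1\<close> and \<open>C\<close> of size \<open>k\<close>. Column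
  \<open>j + 1\<close> of \<open>B\<close> arises from column \<open>j + 1\<close> of \<open>C\<close> by appending a zero below, and from column \<open>j\<close> of \<open>C\<close> by
  prepending a zero above. Comparison shows that \<open>C\<close> is constant along diagonals, that its top row
  vanishes to the right of the corner, and that its bottom row vanishes to the left of its last entry.\<close>

lemma toeplitz_scalar:
  fixes b c :: "nat \<Rightarrow> nat \<Rightarrow> 'a::zero"
  assumes b0: "\<And>i j. i \<le> k \<Longrightarrow> j < k \<Longrightarrow> b i j = (if i < k then c i j else 0)"
    and b1: "\<And>i j. i \<le> k \<Longrightarrow> j < k \<Longrightarrow> b i (Suc j) = (if i = 0 then 0 else c (i - 1) j)"
  shows c_scalar: "i < k \<Longrightarrow> j < k \<Longrightarrow> c i j = (if i = j then c 0 0 else 0)"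
    and b_scalar: "0 < k \<Longrightarrow> i \<le> k \<Longrightarrow> j \<le> k \<Longrightarrow> b i j = (if i = j then c 0 0 else 0)"
proof -
  have diag: "c (Suc i) (Suc j) = c i j" if "Suc i < k" "Suc j < k" for i j
    using b0[of "Suc i" "Suc j"] b1[of "Suc i" j] that by simp
  have top: "c 0 (Suc j) = 0" if "Suc j < k" for j
    using b0[of 0 "Suc j"] b1[of 0 j] that by simp
  have bottom: "c (k - 1) j = 0" if "Suc j < k" for j
    using b0[of k "Suc j"] b1[of k j] that by simp
  have eq: "c i i = c 0 0" if "i < k" for i
    using that by (induction i) (simp_all add: diag)
  have upper: "c i j = 0" if "i < j" "j < k" for i j
    using that
  proof (induction i arbitrary: j)
    case 0
    then show ?case using top[of "j - 1"] by simp
  next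
    case (Suc i)
    then show ?case using diag[of i "j - 1"] Suc.IH[of "j - 1"] by simp
  qed
  have lower: "c i j = 0" if "j < i" "i < k" for i j
    using that
  proof (induction "k - 1 - i" arbitrary: i j)
    case 0
    then have "i = k - 1" by simp
    then show ?case using bottom[of j] 0 by simp
  next
    case (Suc n)
    then show ?case using diag[of i j] Suc(1)[of "Suc i" "Suc j"] by simp
  qed
  show c: "c i j = (if i = j then c 0 0 else 0)" if "i < k" "j < k" for i j
    using eq upper lower that by (metis linorder_neqE_nat)
  show "b i j = (if i = j then c 0 0 else 0)" if "0 < k" "i \<le> k" "j \<le> k"
  proof (cases "j < k")
    case True
    then show ?thesis using b0[of i j] c[of i j] that by auto
  next
    case False
    with that have "j = Suc (k - 1)" by simp
    then show ?thesis using b1[of i "k - 1"] c[of "i - 1" "k - 1"] that by auto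
  qed
qed

lemma mat_mult_nth: "(mat c ** N) $ i $ j = c * N $ i $ (j :: 'n::finite)"
  for N :: "'a::field^'n^'m::finite"
  by (simp add: matrix_matrix_mult_def mat_def if_distrib if_distribR cong: if_cong)

lemma mult_mat_nth: "(N ** mat c) $ i $ j = N $ i $ j * c"
  for N :: "'a::field^'n::finite^'m::finite"
  by (simp add: matrix_matrix_mult_def mat_def if_distrib if_distribR cong: if_cong)

lemma mat_mult_mat: "mat a ** mat b = (mat (a * b) :: 'a::field^'n::finite^'n)"
proof -
  have "(mat a ** mat b) $ i $ j = (mat (a * b) :: 'a^'n^'n) $ i $ j" for i j
    by (simp only: mat_mult_nth) (simp add: mat_def)
  then show ?thesis by (simp add: vec_eq_iff)
qed

lemma standard_stabilizer:
  fixes A :: "'a::field^'n::finite^'n" and B :: "'a^'m::finite^'m"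
  assumes card: "CARD('m) = CARD('n) + 1" and "invertible A"
    and fixed: "nat_act (A, B) standard_hypermatrix = standard_hypermatrix"
  shows "(A, B) \<in> scalarN"
proof -
  let ?S = "standard_hypermatrix :: ('a, 'n, 'm) hypermatrix"
  define k where "k = CARD('n)"
  have "0 < k" by (simp add: k_def)
  obtain C where C: "transpose A ** C = mat 1"
    using invertible_transpose[OF \<open>invertible A\<close>] unfolding invertible_def by blast
  have BS: "B ** ?S $ p = ?S $ p ** C" for p
  proof -
    have "B ** ?S $ p ** transpose A = ?S $ p"
      using arg_cong[OF fixed, of "\<lambda>M. M $ p"] by (simp add: nat_act_def)
    then have "?S $ p ** C = (B ** ?S $ p ** transpose A) ** C"
      by simp
    then show ?thesis
      by (simp add: matrix_mul_assoc[symmetric] C)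
  qed
  define b where "b i j = B $ elt i $ elt j" for i j
  define c where "c i j = C $ elt i $ elt j" for i j
  have b0: "b i j = (if i < k then c i j else 0)" if "i \<le> k" "j < k" for i j
  proof -
    have i: "idx (elt i :: 'm) = i" and j: "idx (elt j :: 'n) = j"
      using that by (simp_all add: card k_def)
    have "(B ** ?S $ 0) $ elt i $ (elt j :: 'n) =
        (\<Sum>l\<in>UNIV. if j = idx l then B $ elt i $ l else 0)"
      by (simp add: matrix_matrix_mult_def standard_slice_0 j if_distribR if_distrib
          eq_commute[of j] cong: if_cong)
    also have "\<dots> = b i j" using that by (simp add: sum_delta_idx card k_def b_def)
    finally have "b i j = (?S $ 0 ** C) $ elt i $ elt j" by (simp add: BS)
    also have "\<dots> = (\<Sum>l\<in>UNIV. if i = idx l then C $ l $ elt j else 0)"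
      by (simp add: matrix_matrix_mult_def standard_slice_0 i if_distribR if_distrib cong: if_cong)
    also have "\<dots> = (if i < k then c i j else 0)" by (simp add: sum_delta_idx c_def k_def)
    finally show ?thesis .
  qed
  have b1: "b i (Suc j) = (if i = 0 then 0 else c (i - 1) j)" if "i \<le> k" "j < k" for i j
  proof -
    have i: "idx (elt i :: 'm) = i" and j: "idx (elt j :: 'n) = j"
      using that by (simp_all add: card k_def)
    have "(B ** ?S $ 1) $ elt i $ (elt j :: 'n) =
        (\<Sum>l\<in>UNIV. if Suc j = idx l then B $ elt i $ l else 0)"
      by (simp add: matrix_matrix_mult_def standard_slice_1 j if_distribR if_distrib
          eq_commute[of "Suc j"] cong: if_cong)
    also have "\<dots> = b i (Suc j)" using that by (simp add: sum_delta_idx card k_def b_def)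
    finally have "b i (Suc j) = (?S $ 1 ** C) $ elt i $ elt j" by (simp add: BS)
    also have "\<dots> = (\<Sum>l\<in>UNIV. if i = Suc (idx l) then C $ l $ elt j else 0)"
      by (simp add: matrix_matrix_mult_def standard_slice_1 i if_distribR if_distrib cong: if_cong)
    also have "\<dots> = (if i = 0 then 0 else c (i - 1) j)"
      using that by (auto simp: sum_delta_Suc_idx c_def k_def)
    finally show ?thesis .
  qed
  define a where "a = c 0 0"
  have "C $ i $ j = (if i = j then a else 0)" for i j
    using c_scalar[of k b c "idx i" "idx j"] b0 b1 idx_less[of i] idx_less[of j]
    by (simp add: c_def[of "idx i" "idx j"] a_def k_def)
  then have Ca: "C = mat a" by (simp add: vec_eq_iff mat_def)
  have "B $ i $ j = (if i = j then a else 0)" for i j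
    using b_scalar[of k b c "idx i" "idx j"] b0 b1 idx_less[of i] idx_less[of j] \<open>0 < k\<close>
    by (simp add: b_def[of "idx i" "idx j"] a_def k_def card)
  then have Ba: "B = mat a" by (simp add: vec_eq_iff mat_def)
  have "a \<noteq> 0"
  proof
    assume "a = 0"
    with C Ca have "(mat 1 :: 'a^'n^'n) = 0" by simp
    then have "(mat 1 :: 'a^'n^'n) $ undefined $ undefined = 0" by simp
    then show False by (simp add: mat_def)
  qed
  have "transpose A = transpose A ** (C ** mat (inverse a))"
    by (simp add: Ca mat_mult_mat \<open>a \<noteq> 0\<close>)
  also have "\<dots> = mat (inverse a)"
    by (simp add: matrix_mul_assoc C)
  finally have "A = mat (inverse a)"
    by (metis transpose_mat transpose_transpose)
  then show ?thesis
    unfolding scalarN_def using Ba \<open>a \<noteq> 0\<close> by (auto intro!: exI[of _ "inverse a"])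
qed

section \<open>The action on nondegenerate hypermatrices\<close>

lemma group_GL: "group (GL :: ('a::field^'n::finite^'n) monoid)"
proof (rule groupI)
  fix A :: "'a^'n^'n"
  assume "A \<in> carrier GL"
  then obtain A' where "A ** A' = mat 1" "A' ** A = mat 1"
    by (auto simp: GL_def invertible_def)
  then show "\<exists>A'\<in>carrier GL. A' \<otimes>\<^bsub>GL\<^esub> A = \<one>\<^bsub>GL\<^esub>"
    by (auto simp: GL_def invertible_def intro!: bexI[of _ A'])
qed (auto simp: GL_def invertible_mult matrix_mul_assoc invertible_def[of "mat 1"])

lemma group_GLprod: "group (GLprod :: (('a::field^'n::finite^'n) \<times> ('a^'m::finite^'m)) monoid)"
  unfolding GLprod_def by (intro DirProd_group group_GL)

lemma carrier_GLprod [simp]: "(A, B) \<in> carrier GLprod \<longleftrightarrow> invertible A \<and> invertible B"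
  by (simp add: GLprod_def GL_def)

lemma mult_GLprod [simp]: "(A, B) \<otimes>\<^bsub>GLprod\<^esub> (A', B') = (A ** A', B ** B')"
  by (simp add: GLprod_def GL_def)

lemma one_GLprod: "\<one>\<^bsub>GLprod\<^esub> = (mat 1, mat 1)"
  by (simp add: GLprod_def GL_def)

lemma nat_act_one: "nat_act \<one>\<^bsub>GLprod\<^esub> M = M"
  by (simp add: one_GLprod nat_act_def)

lemma nat_act_mult: "nat_act (g \<otimes>\<^bsub>GLprod\<^esub> h) M = nat_act g (nat_act h M)"
  by (cases g, cases h) (simp add: nat_act_def matrix_transpose_mul matrix_mul_assoc)

lemma mat_mult_commute: "mat c ** A = A ** mat c" for A :: "'a::field^'n::finite^'n"
  by (simp add: vec_eq_iff mat_mult_nth mult_mat_nth mult.commute)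

lemma scalarN_central:
  "n \<in> scalarN \<Longrightarrow> n \<otimes>\<^bsub>GLprod\<^esub> g = g \<otimes>\<^bsub>GLprod\<^esub> n"
  by (cases g) (auto simp: scalarN_def mat_mult_commute)

lemma scalarN_subset: "scalarN \<subseteq> carrier GLprod"
  by (auto simp: scalarN_def invertible_def)
     (metis mat_mult_mat right_inverse left_inverse inverse_nonzero_iff_nonzero)+

lemma subgroup_scalarN: "subgroup scalarN GLprod"
proof (rule group.subgroupI[OF group_GLprod scalarN_subset])
  show "scalarN \<noteq> {}" by (auto simp: scalarN_def intro: exI[of _ 1])
next
  fix n :: "('a^'n^'n) \<times> ('a^'m^'m)"
  assume n: "n \<in> scalarN"
  then obtain c where c: "n = (mat c, mat (inverse c))" "c \<noteq> 0"
    by (auto simp: scalarN_def)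
  then have n': "(mat (inverse c), mat c) \<in> (scalarN :: (('a^'n^'n) \<times> ('a^'m^'m)) set)"
    by (auto simp: scalarN_def intro!: exI[of _ "inverse c"])
  have "inv\<^bsub>GLprod\<^esub> n = (mat (inverse c), mat c)"
    by (rule group.inv_equality[OF group_GLprod])
       (use n n' c scalarN_subset in \<open>auto simp: mat_mult_mat one_GLprod\<close>)
  with n' show "inv\<^bsub>GLprod\<^esub> n \<in> scalarN" by simp
next
  fix m n :: "('a^'n^'n) \<times> ('a^'m^'m)"
  assume "m \<in> scalarN" "n \<in> scalarN"
  then obtain c d where "m = (mat c, mat (inverse c))" "n = (mat d, mat (inverse d))"
      "c \<noteq> 0" "d \<noteq> 0"
    by (auto simp: scalarN_def)
  then show "m \<otimes>\<^bsub>GLprod\<^esub> n \<in> scalarN"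
    by (auto simp: scalarN_def mat_mult_mat intro!: exI[of _ "c * d"])
qed

lemma nat_act_scalarN: "n \<in> scalarN \<Longrightarrow> nat_act n M = M"
  by (auto simp: scalarN_def nat_act_def vec_eq_iff mat_mult_nth mult_mat_nth)

lemma nondegenerate_iff:
  fixes M :: "('a::field, 'n::finite, 'm::finite) hypermatrix"
  assumes "CARD('m) = CARD('n) + 1"
  shows "M \<in> nondegenerate_hypermatrices \<longleftrightarrow> pencil_injective (to_ac_hypermatrix M)"
  using degenerate_iff_not_pencil_injective[OF assms, of M] by (simp add: nondegenerate_hypermatrices_def)

lemma standard_nondegenerate:
  assumes "CARD('m) = CARD('n) + 1"
  shows "(standard_hypermatrix :: ('a::field, 'n::finite, 'm::finite) hypermatrix)
    \<in> nondegenerate_hypermatrices"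
  unfolding nondegenerate_iff[OF assms] to_ac_standard by (rule standard_pencil_injective[OF assms])

lemma nat_act_nondegenerate:
  fixes M :: "('a::field, 'n::finite, 'm::finite) hypermatrix"
  assumes "CARD('m) = CARD('n) + 1" "g \<in> carrier GLprod" "M \<in> nondegenerate_hypermatrices"
  shows "nat_act g M \<in> nondegenerate_hypermatrices"
  using assms(2,3) unfolding nondegenerate_iff[OF assms(1)]
  by (cases g) (simp add: pencil_injective_nat_act)

lemma nondegenerate_orbit:
  fixes M :: "('a::field, 'n::finite, 'm::finite) hypermatrix"
  assumes "CARD('m) = CARD('n) + 1" "M \<in> nondegenerate_hypermatrices"
  obtains g where "g \<in> carrier GLprod" "M = nat_act g standard_hypermatrix"
proof -
  obtain A B where "invertible A" "invertible B" "M = nat_act (A, B) standard_hypermatrix"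
    using canonical_form[OF assms(1)] assms(2) unfolding nondegenerate_iff[OF assms(1)] by blast
  then show thesis using that[of "(A, B)"] by simp
qed

text \<open>By transitivity it suffices to treat the standard hypermatrix: conjugation moves the stabilizer of
  \<open>M\<close> into that of the standard one, and elements of \<open>N\<close> are unchanged by conjugation, being central.\<close>

lemma nat_act_stabilizer:
  fixes M :: "('a::field, 'n::finite, 'm::finite) hypermatrix"
  assumes card: "CARD('m) = CARD('n) + 1" and M: "M \<in> nondegenerate_hypermatrices"
    and g: "g \<in> carrier GLprod" and fixed: "nat_act g M = M"
  shows "g \<in> scalarN"
proof -
  interpret group "GLprod :: (('a^'n^'n) \<times> ('a^'m^'m)) monoid" by (rule group_GLprod)
  obtain h where h: "h \<in> carrier GLprod" "M = nat_act h standard_hypermatrix"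
    using nondegenerate_orbit[OF card M] by blast
  define n where "n = inv\<^bsub>GLprod\<^esub> h \<otimes>\<^bsub>GLprod\<^esub> (g \<otimes>\<^bsub>GLprod\<^esub> h)"
  have n: "n \<in> carrier GLprod" using g h by (simp add: n_def)
  have "nat_act n standard_hypermatrix = nat_act (inv\<^bsub>GLprod\<^esub> h) (nat_act g M)"
    by (simp add: n_def nat_act_mult h)
  also have "\<dots> = nat_act (inv\<^bsub>GLprod\<^esub> h \<otimes>\<^bsub>GLprod\<^esub> h) standard_hypermatrix"
    by (simp only: fixed nat_act_mult h(2)[symmetric])
  also have "\<dots> = standard_hypermatrix" using h by (simp add: nat_act_one)
  finally have "n \<in> scalarN"
    using n by (cases n) (auto intro: standard_stabilizer[OF card])
  have "g \<otimes>\<^bsub>GLprod\<^esub> h = h \<otimes>\<^bsub>GLprod\<^esub> inv\<^bsub>GLprod\<^esub> h \<otimes>\<^bsub>GLprod\<^esub> (g \<otimes>\<^bsub>GLprod\<^esub> h)"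
    using g h(1) by simp
  also have "\<dots> = h \<otimes>\<^bsub>GLprod\<^esub> n"
    using g h(1) by (simp only: n_def m_assoc m_closed inv_closed)
  also have "\<dots> = n \<otimes>\<^bsub>GLprod\<^esub> h"
    using scalarN_central[OF \<open>n \<in> scalarN\<close>] by simp
  finally have "g = n" using g h(1) n by simp
  then show ?thesis using \<open>n \<in> scalarN\<close> by simp
qed

text \<open>The elements of \<^const>\<open>BijGroup\<close> are extensional functions, so a permutation of the nondegenerate
  hypermatrices has to be undefined elsewhere.\<close>

definition nondegenerate_act ::
    "('a::field^'n::finite^'n) \<times> ('a^'m::finite^'m) \<Rightarrow>
     ('a, 'n, 'm) hypermatrix \<Rightarrow> ('a, 'n, 'm) hypermatrix" where
  "nondegenerate_act g = restrict (nat_act g) nondegenerate_hypermatrices"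

lemma nondegenerate_act_group_hom:
  assumes card: "CARD('m) = CARD('n) + 1"
  shows "group_hom GLprod
    (BijGroup (nondegenerate_hypermatrices :: ('a::field, 'n::finite, 'm::finite) hypermatrix set))
    nondegenerate_act"
proof -
  let ?E = "nondegenerate_hypermatrices :: ('a, 'n, 'm) hypermatrix set"
  interpret group "GLprod :: (('a^'n^'n) \<times> ('a^'m^'m)) monoid" by (rule group_GLprod)
  note closed = nat_act_nondegenerate[OF card]
  have cancel: "nat_act (inv\<^bsub>GLprod\<^esub> g) (nat_act g M) = M"
    "nat_act g (nat_act (inv\<^bsub>GLprod\<^esub> g) M) = M"
    if "g \<in> carrier GLprod" for g and M :: "('a, 'n, 'm) hypermatrix"
    using that by (simp_all flip: nat_act_mult add: nat_act_one)
  have bij: "nondegenerate_act g \<in> Bij ?E" if g: "g \<in> carrier GLprod" for g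
  proof -
    have "bij_betw (nat_act g) ?E ?E"
      by (rule bij_betw_byWitness[where f' = "nat_act (inv\<^bsub>GLprod\<^esub> g)"])
         (use closed[OF g] closed[OF inv_closed[OF g]] cancel[OF g] in auto)
    then show ?thesis
      by (simp add: Bij_def nondegenerate_act_def cong: bij_betw_cong)
  qed
  show ?thesis
  proof (intro group_hom.intro group_hom_axioms.intro homI group_GLprod group_BijGroup)
    show "nondegenerate_act g \<in> carrier (BijGroup ?E)" if "g \<in> carrier GLprod" for g
      using bij[OF that] by (simp add: BijGroup_def)
    show "nondegenerate_act (g \<otimes>\<^bsub>GLprod\<^esub> h) =
        nondegenerate_act g \<otimes>\<^bsub>BijGroup ?E\<^esub> nondegenerate_act h"
      if "g \<in> carrier GLprod" "h \<in> carrier GLprod" for g h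
      using bij[OF that(1)] bij[OF that(2)] closed[OF that(2)]
      by (auto simp: BijGroup_def compose_def nondegenerate_act_def nat_act_mult restrict_def fun_eq_iff)
  qed
qed

text \<open>The kernel fixes the standard hypermatrix, whose stabilizer is already \<open>N\<close>. In particular \<open>N\<close> is
  normal, and the action descends to the quotient group.\<close>

lemma kernel_nondegenerate_act:
  assumes card: "CARD('m) = CARD('n) + 1"
  shows "kernel GLprod
    (BijGroup (nondegenerate_hypermatrices :: ('a::field, 'n::finite, 'm::finite) hypermatrix set))
    nondegenerate_act = scalarN"
proof (intro equalityI subsetI)
  let ?E = "nondegenerate_hypermatrices :: ('a, 'n, 'm) hypermatrix set"
  fix g :: "('a^'n^'n) \<times> ('a^'m^'m)"
  show "g \<in> scalarN" if "g \<in> kernel GLprod (BijGroup ?E) nondegenerate_act"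
  proof -
    from that have g: "g \<in> carrier GLprod" "nondegenerate_act g = (\<lambda>M\<in>?E. M)"
      by (auto simp: kernel_def BijGroup_def)
    note S = standard_nondegenerate[OF card, where 'a = 'a]
    have "nat_act g standard_hypermatrix = (standard_hypermatrix :: ('a, 'n, 'm) hypermatrix)"
      using fun_cong[OF g(2), of standard_hypermatrix] S by (simp add: nondegenerate_act_def)
    then show ?thesis by (rule nat_act_stabilizer[OF card S g(1)])
  qed
  show "g \<in> kernel GLprod (BijGroup ?E) nondegenerate_act" if "g \<in> scalarN"
    using that scalarN_subset
    by (auto simp: kernel_def BijGroup_def nondegenerate_act_def nat_act_scalarN)
qed

section \<open>Continuity\<close>

lemma continuous_on_matrix_mult:
  fixes f :: "'t::topological_space \<Rightarrow> 'a::topological_field^'n::finite^'m::finite"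
    and g :: "'t \<Rightarrow> 'a^'p::finite^'n"
  assumes "continuous_on S f" "continuous_on S g"
  shows "continuous_on S (\<lambda>x. f x ** g x)"
  using assms unfolding continuous_on_def matrix_matrix_mult_def
  by (intro ballI tendsto_vec_lambda tendsto_sum tendsto_mult tendsto_vec_nth) auto

lemma continuous_on_transpose:
  fixes f :: "'t::topological_space \<Rightarrow> 'a::topological_space^'n::finite^'m::finite"
  assumes "continuous_on S f"
  shows "continuous_on S (\<lambda>x. transpose (f x))"
  using assms unfolding continuous_on_def transpose_def
  by (intro ballI tendsto_vec_lambda tendsto_vec_nth) auto

lemma continuous_on_nat_act:
  "continuous_on S (\<lambda>(g, M). nat_act g M :: ('a::topological_field, 'n::finite, 'm::finite) hypermatrix)"
proof -
  have "continuous_on S (\<lambda>x. snd (fst x) ** (snd x $ p) ** transpose (fst (fst x)))"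
    for p and S :: "((('a^'n^'n) \<times> ('a^'m^'m)) \<times> ('a, 'n, 'm) hypermatrix) set"
    by (intro continuous_on_matrix_mult continuous_on_transpose continuous_on_fst continuous_on_snd
        continuous_on_id continuous_on_component)
  then show ?thesis
    unfolding nat_act_def split_def by (rule continuous_on_vec_lambda)
qed

text \<open>The saturation of an open set \<open>U\<close> is the union of its preimages under multiplication by the elements
  of \<open>N\<close>, and these multiplications are continuous.\<close>

lemma open_map_coset:
  "open_map GLprod_topology
     (Ggrp_topology :: (('a::topological_field^'n::finite^'n) \<times> ('a^'m::finite^'m)) set topology)
     (\<lambda>g. scalarN #>\<^bsub>GLprod\<^esub> g)"
proof -
  let ?G = "GLprod :: (('a^'n^'n) \<times> ('a^'m^'m)) monoid"
  let ?q = "\<lambda>g. scalarN #>\<^bsub>?G\<^esub> g"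
  interpret group ?G by (rule group_GLprod)
  interpret N: subgroup "scalarN :: (('a^'n^'n) \<times> ('a^'m^'m)) set" ?G
    by (rule subgroup_scalarN)
  show ?thesis
    unfolding open_map_def Ggrp_topology_def openin_quotient_topology
  proof (intro allI impI conjI)
    fix U :: "(('a^'n^'n) \<times> ('a^'m^'m)) set"
    assume U: "openin GLprod_topology U"
    then have "U \<subseteq> topspace GLprod_topology" by (rule openin_subset)
    then show "?q ` U \<subseteq> ?q ` topspace GLprod_topology" by blast
    have sub: "U \<subseteq> carrier ?G"
      using \<open>U \<subseteq> topspace GLprod_topology\<close> by (simp add: GLprod_topology_def)
    have "{g \<in> topspace GLprod_topology. ?q g \<in> ?q ` U} =
        (\<Union>n\<in>scalarN. {g \<in> topspace GLprod_topology. n \<otimes>\<^bsub>?G\<^esub> g \<in> U})"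
    proof (intro equalityI subsetI)
      fix g assume "g \<in> {g \<in> topspace GLprod_topology. ?q g \<in> ?q ` U}"
      then obtain u where g: "g \<in> carrier ?G" and u: "u \<in> U" "?q g = ?q u"
        by (auto simp: GLprod_topology_def)
      then have "u \<in> ?q g"
        using rcos_self[OF _ subgroup_scalarN, of u] sub by auto
      then show "g \<in> (\<Union>n\<in>scalarN. {g \<in> topspace GLprod_topology. n \<otimes>\<^bsub>?G\<^esub> g \<in> U})"
        using g u by (auto simp: r_coset_def GLprod_topology_def)
    next
      fix g assume "g \<in> (\<Union>n\<in>scalarN. {g \<in> topspace GLprod_topology. n \<otimes>\<^bsub>?G\<^esub> g \<in> U})"
      then obtain n where n: "n \<in> scalarN" and g: "g \<in> carrier ?G" "n \<otimes>\<^bsub>?G\<^esub> g \<in> U"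
        by (auto simp: GLprod_topology_def)
      have "?q (n \<otimes>\<^bsub>?G\<^esub> g) = ?q g"
        using coset_mult_assoc[OF N.subset N.mem_carrier[OF n] g(1)]
          coset_join2[OF N.mem_carrier[OF n] subgroup_scalarN n] by simp
      then show "g \<in> {g \<in> topspace GLprod_topology. ?q g \<in> ?q ` U}"
        using g by (auto simp: GLprod_topology_def image_iff intro!: bexI[of _ "n \<otimes>\<^bsub>?G\<^esub> g"])
    qed
    also have "openin GLprod_topology \<dots>"
    proof (intro openin_Union ballI, clarify)
      fix n :: "('a^'n^'n) \<times> ('a^'m^'m)" assume n: "n \<in> scalarN"
      have "n \<otimes>\<^bsub>?G\<^esub> g = (fst n ** fst g, snd n ** snd g)" for g
        by (cases n, cases g) simp
      then have "continuous_on (carrier ?G) (\<lambda>g. n \<otimes>\<^bsub>?G\<^esub> g)"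
        by (simp only:) (intro continuous_on_Pair continuous_on_matrix_mult continuous_on_const
            continuous_on_fst continuous_on_snd continuous_on_id)
      then have "continuous_map GLprod_topology GLprod_topology (\<lambda>g. n \<otimes>\<^bsub>?G\<^esub> g)"
        using n N.subset unfolding GLprod_topology_def
        by (auto simp: continuous_map_in_subtopology simp del: mult_GLprod)
      then show "openin GLprod_topology {g \<in> topspace GLprod_topology. n \<otimes>\<^bsub>?G\<^esub> g \<in> U}"
        using U by (rule openin_continuous_map_preimage)
    qed
    finally show "openin GLprod_topology {g \<in> topspace GLprod_topology. ?q g \<in> ?q ` U}" .
  qed
qed

text \<open>The product of a quotient map with an identity map need not be a quotient map, but openness does
  survive products. It is what makes the action of the quotient group jointly continuous.\<close>

lemma open_map_prod_id:
  assumes "open_map T T' q"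
  shows "open_map (prod_topology T Z) (prod_topology T' Z) (\<lambda>(x, z). (q x, z))"
  unfolding open_map_def
proof (intro allI impI)
  let ?f = "\<lambda>(x, z). (q x, z)"
  fix U assume U: "openin (prod_topology T Z) U"
  show "openin (prod_topology T' Z) (?f ` U)"
    unfolding openin_prod_topology_alt
  proof (intro allI impI)
    fix y z assume "(y, z) \<in> ?f ` U"
    then obtain x where x: "(x, z) \<in> U" "y = q x" by auto
    then obtain V W where VW: "openin T V" "openin Z W" "x \<in> V" "z \<in> W" "V \<times> W \<subseteq> U"
      using U[unfolded openin_prod_topology_alt, rule_format, OF x(1)] by (elim exE conjE)
    have "openin T' (q ` V)" using assms VW(1) by (simp add: open_map_def)
    moreover have "q ` V \<times> W \<subseteq> ?f ` U"
    proof
      fix p assume "p \<in> q ` V \<times> W"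
      then obtain v w where "p = ?f (v, w)" "v \<in> V" "w \<in> W" by auto
      moreover from this VW(5) have "(v, w) \<in> U" by auto
      ultimately show "p \<in> ?f ` U" by (simp only: imageI)
    qed
    moreover have "y \<in> q ` V" using x(2) VW(3) by blast
    ultimately show "\<exists>V' W. openin T' V' \<and> openin Z W \<and> y \<in> V' \<and> z \<in> W \<and> V' \<times> W \<subseteq> ?f ` U"
      using VW(2,4) by (intro exI conjI)
  qed
qed

section \<open>The simply transitive action\<close>

theorem theorem2p2:
  fixes k :: nat
    and E :: "('a::topological_field, 'n::finite, 'm::finite) hypermatrix set"
    and G :: "(('a^'n^'n) \<times> ('a^'m^'m)) set monoid"
  assumes "k \<ge> 1" and "CARD('n) = k" and "CARD('m) = k + 1"
  defines "E \<equiv> nondegenerate_hypermatrices" and "G \<equiv> Ggrp"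
  shows "\<exists>\<phi>. transitive_action G E \<phi> \<and> E \<noteq> {} \<and>
           (\<forall>M\<in>E. stabilizer G \<phi> M = {\<one>\<^bsub>G\<^esub>}) \<and>
           continuous_map (prod_topology Ggrp_topology (top_of_set E)) (top_of_set E)
             (\<lambda>(g, M). \<phi> g M) \<and>
           (\<forall>h\<in>carrier GLprod. \<forall>M\<in>E. \<phi> (scalarN #>\<^bsub>GLprod\<^esub> h) M = nat_act h M)"
proof -
  let ?N = "scalarN :: (('a^'n^'n) \<times> ('a^'m^'m)) set"
  let ?GL = "GLprod :: (('a^'n^'n) \<times> ('a^'m^'m)) monoid"
  let ?q = "\<lambda>h. ?N #>\<^bsub>?GL\<^esub> h"
  have card: "CARD('m) = CARD('n) + 1" using assms by simp
  interpret group ?GL by (rule group_GLprod)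
  interpret act: group_hom ?GL "BijGroup E" nondegenerate_act
    unfolding E_def by (rule nondegenerate_act_group_hom[OF card])
  have kernel: "kernel ?GL (BijGroup E) nondegenerate_act = ?N"
    unfolding E_def by (rule kernel_nondegenerate_act[OF card])
  have normal: "?N \<lhd> ?GL"
    using act.normal_kernel unfolding kernel .
  obtain \<phi> where \<phi>_hom: "\<phi> \<in> hom (?GL Mod ?N) (BijGroup E)"
    and \<phi>: "\<And>h. h \<in> carrier ?GL \<Longrightarrow> \<phi> (?q h) = nondegenerate_act h"
    using act.FactGroup_universal_kernel[OF normal] unfolding kernel by blast
  have \<phi>_nat_act: "\<phi> (?q h) M = nat_act h M" if "h \<in> carrier ?GL" "M \<in> E" for h M
    using that \<phi> by (simp add: nondegenerate_act_def E_def)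
  have carrier_G: "carrier G = ?q ` carrier ?GL"
    unfolding G_def Ggrp_def by (rule carrier_FactGroup)

  have "transitive_action G E \<phi>"
  proof (intro transitive_action.intro group_action.intro transitive_action_axioms.intro)
    show "group_hom G (BijGroup E) \<phi>"
      unfolding G_def Ggrp_def
      by (intro group_hom.intro group_hom_axioms.intro normal.factorgroup_is_group[OF normal]
          group_BijGroup \<phi>_hom)
    fix M M' assume "M \<in> E" "M' \<in> E"
    obtain g where g: "g \<in> carrier ?GL" "M = nat_act g standard_hypermatrix"
      using nondegenerate_orbit[OF card] \<open>M \<in> E\<close> unfolding E_def by blast
    obtain h where h: "h \<in> carrier ?GL" "M' = nat_act h standard_hypermatrix"
      using nondegenerate_orbit[OF card] \<open>M' \<in> E\<close> unfolding E_def by blast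
    let ?t = "h \<otimes>\<^bsub>?GL\<^esub> inv\<^bsub>?GL\<^esub> g"
    have t: "?t \<in> carrier ?GL" using g(1) h(1) by simp
    have "nat_act ?t M = nat_act (?t \<otimes>\<^bsub>?GL\<^esub> g) standard_hypermatrix"
      by (simp only: g(2) nat_act_mult)
    also have "?t \<otimes>\<^bsub>?GL\<^esub> g = h" using g(1) h(1) by (simp add: m_assoc)
    finally have "\<phi> (?q ?t) M = M'"
      using \<phi>_nat_act[OF t \<open>M \<in> E\<close>] h(2) by simp
    with t show "\<exists>g\<in>carrier G. \<phi> g M = M'" unfolding carrier_G by blast
  qed
  moreover have "E \<noteq> {}"
    using standard_nondegenerate[OF card] unfolding E_def by blast
  moreover have "stabilizer G \<phi> M = {\<one>\<^bsub>G\<^esub>}" if M: "M \<in> E" for M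
  proof -
    have one: "\<one>\<^bsub>G\<^esub> = ?N" by (simp add: G_def Ggrp_def)
    have N: "?N = ?q \<one>\<^bsub>?GL\<^esub>"
      by (rule sym, rule coset_join2[OF one_closed subgroup_scalarN
            subgroup.one_closed[OF subgroup_scalarN]])
    show ?thesis
      unfolding stabilizer_def carrier_G one
    proof (intro equalityI subsetI)
      fix g assume "g \<in> {g \<in> ?q ` carrier ?GL. \<phi> g M = M}"
      then obtain h where h: "h \<in> carrier ?GL" "g = ?q h" "\<phi> (?q h) M = M" by blast
      then have "h \<in> ?N"
        using nat_act_stabilizer[OF card _ h(1)] M \<phi>_nat_act[OF h(1) M] unfolding E_def by simp
      then show "g \<in> {?N}" using coset_join2[OF h(1) subgroup_scalarN] h(2) by simp
    next
      fix g assume "g \<in> {?N}"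
      then have "g = ?q \<one>\<^bsub>?GL\<^esub>" using N by simp
      moreover have "\<phi> (?q \<one>\<^bsub>?GL\<^esub>) M = M"
        using \<phi>_nat_act[OF one_closed M] by (simp only: nat_act_one)
      ultimately show "g \<in> {g \<in> ?q ` carrier ?GL. \<phi> g M = M}"
        using one_closed by blast
    qed
  qed
  moreover have "continuous_map (prod_topology Ggrp_topology (top_of_set E)) (top_of_set E)
      (\<lambda>(g, M). \<phi> g M)"
  proof -
    let ?T = "GLprod_topology :: (('a^'n^'n) \<times> ('a^'m^'m)) topology"
    let ?Q = "\<lambda>(h, M). (?q h, M :: ('a, 'n, 'm) hypermatrix)"
    have q: "continuous_map ?T Ggrp_topology ?q"
      unfolding Ggrp_topology_def
      by (rule quotient_imp_continuous_map[OF quotient_map_quotient_topology])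
    have "continuous_map (prod_topology ?T (top_of_set E)) Ggrp_topology (\<lambda>p. ?q (fst p))"
      using continuous_map_compose[OF continuous_map_fst q] by (simp add: o_def)
    then have "continuous_map (prod_topology ?T (top_of_set E))
        (prod_topology Ggrp_topology (top_of_set E)) ?Q"
      unfolding split_def by (rule continuous_map_pairedI[OF _ continuous_map_snd])
    moreover have "open_map (prod_topology ?T (top_of_set E))
        (prod_topology Ggrp_topology (top_of_set E)) ?Q"
      by (rule open_map_prod_id[OF open_map_coset])
    moreover have "?Q ` topspace (prod_topology ?T (top_of_set E)) =
        topspace (prod_topology Ggrp_topology (top_of_set E))"
      by (auto simp: Ggrp_topology_def topspace_quotient_topology image_iff)
    ultimately have quot: "quotient_map (prod_topology ?T (top_of_set E))
        (prod_topology Ggrp_topology (top_of_set E)) ?Q"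
      by (rule continuous_open_imp_quotient_map)
    have "continuous_map (prod_topology ?T (top_of_set E)) (top_of_set E)
        (\<lambda>(h, M). nat_act h M)"
      unfolding GLprod_topology_def prod_topology_subtopology_eu continuous_map_in_subtopology
      using nat_act_nondegenerate[OF card] continuous_on_nat_act by (auto simp: E_def)
    then have "continuous_map (prod_topology ?T (top_of_set E)) (top_of_set E)
        ((\<lambda>(g, M). \<phi> g M) \<circ> ?Q)"
    proof (rule continuous_map_eq)
      fix x assume "x \<in> topspace (prod_topology ?T (top_of_set E))"
      then show "(case x of (h, M) \<Rightarrow> nat_act h M) = ((\<lambda>(g, M). \<phi> g M) \<circ> ?Q) x"
        using \<phi>_nat_act by (cases x) (simp add: GLprod_topology_def)
    qed
    \<comment> \<open>A map out of \<open>G \<times> E\<close> is continuous once its pullback to \<open>(GL\<^sub>k \<times> GL\<^sub>k\<^sub>+\<^sub>1) \<times> E\<close> is.\<close>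
    with quot show ?thesis by (rule continuous_compose_quotient_map)
  qed
  ultimately show ?thesis using \<phi>_nat_act by blast
qed

end
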